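(* Let $\{a_p\}_{p\ge2}$ and $\sigma$ be as in the context and let $u\in W^{1,1}_{\rm loc}(\Omega)$ be such that $\sum_{p\ge2}a_p\int_\Omega|\nabla u|^p<\infty$. Then $\|\nabla u\|_{L^\infty(\Omega)}\le\sigma$.
   Context: $\Omega\subset\mathbb{R}^N$ ($N\ge1$) is a bounded, connected, open set with Lipschitz boundary. $\{a_p\}_{p\ge2}$ ($p$ integer) is a real sequence with $a_p\ge0$ for all $p$, $a_2>0$, and $a_p\ne0$ for infinitely many $p$; $\sigma\in[0,+\infty]$ is defined by $1/\sigma=\limsup_{p\to\infty}a_p^{1/p}\in[0,+\infty]$. *)

theory Defs
  imports "HOL-Analysis.Analysis" "HOL-Probability.Essential_Supremum"
begin

(* Near each boundary point the set is, inside a ball, the strict epigraph over some hyperplane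
   {z. z \<bullet> e = 0} of a Lipschitz function; e plays the role of the last vector of a rotated
   coordinate system. In dimension one the hyperplane is {0}. *)
definition lipschitz_boundary :: "'a::euclidean_space set \<Rightarrow> bool" where
  "lipschitz_boundary \<Omega> \<longleftrightarrow>
    (\<forall>x\<in>frontier \<Omega>. \<exists>r>0. \<exists>e \<gamma> L. norm e = 1 \<and>
       L-lipschitz_on {z. z \<bullet> e = 0} (\<gamma> :: 'a \<Rightarrow> real) \<and>
       \<Omega> \<inter> ball x r = {y \<in> ball x r. \<gamma> (y - (y \<bullet> e) *\<^sub>R e) < y \<bullet> e})"

primrec Ck :: "nat \<Rightarrow> ('a::euclidean_space \<Rightarrow> real) \<Rightarrow> bool" where
  "Ck 0 f \<longleftrightarrow> continuous_on UNIV f"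
| "Ck (Suc k) f \<longleftrightarrow> f differentiable_on UNIV \<and>
     (\<forall>i\<in>Basis. Ck k (\<lambda>x. frechet_derivative f (at x) i))"

definition test_function :: "'a::euclidean_space set \<Rightarrow> ('a \<Rightarrow> real) \<Rightarrow> bool" where
  "test_function \<Omega> \<phi> \<longleftrightarrow> (\<forall>k. Ck k \<phi>) \<and>
     compact (closure {x. \<phi> x \<noteq> 0}) \<and> closure {x. \<phi> x \<noteq> 0} \<subseteq> \<Omega>"

definition L1_loc :: "'a::euclidean_space set \<Rightarrow> ('a \<Rightarrow> 'b::euclidean_space) set" where
  "L1_loc \<Omega> = {f. \<forall>K. compact K \<and> K \<subseteq> \<Omega> \<longrightarrow> f absolutely_integrable_on K}"

(* A weak gradient is only determined almost everywhere on \<Omega>, hence a relation. *)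
definition weak_gradient ::
  "'a::euclidean_space set \<Rightarrow> ('a \<Rightarrow> real) \<Rightarrow> ('a \<Rightarrow> 'a) \<Rightarrow> bool" where
  "weak_gradient \<Omega> u g \<longleftrightarrow> g \<in> L1_loc \<Omega> \<and>
     (\<forall>\<phi>. test_function \<Omega> \<phi> \<longrightarrow> (\<forall>i\<in>Basis.
        (LINT x:\<Omega>|lebesgue. u x * frechet_derivative \<phi> (at x) i)
        = - (LINT x:\<Omega>|lebesgue. (g x \<bullet> i) * \<phi> x)))"

definition W11_loc :: "'a::euclidean_space set \<Rightarrow> ('a \<Rightarrow> real) set" where
  "W11_loc \<Omega> = {u \<in> L1_loc \<Omega>. \<exists>g. weak_gradient \<Omega> u g}"

(* The norm in L^\<infinity>(\<Omega>), with value \<infinity> for essentially unbounded functions. *)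
definition Linfty_norm ::
  "'a::euclidean_space set \<Rightarrow> ('a \<Rightarrow> 'b::euclidean_space) \<Rightarrow> ennreal" where
  "Linfty_norm \<Omega> f = esssup (lebesgue_on \<Omega>) (\<lambda>x. ennreal (norm (f x)))"

end

theory Submission imports Defs begin

text \<open>If \<open>A = {f > z}\<close> has positive measure, then each term of the convergent series
  dominates \<open>a p * z ^ p * \<mu> A\<close>. Hence \<open>root p (a p) \<le> root p C / z\<close> for a constant \<open>C\<close>, and
  letting \<open>p\<close> tend to infinity gives \<open>1/\<sigma> \<le> 1/z\<close>. So no level \<open>z > \<sigma>\<close> is exceeded on a set of
  positive measure.\<close>

lemma limsup_root_le_inverse:
  fixes a :: "nat \<Rightarrow> real" and C z :: real
  assumes "z > 0" and bound: "\<forall>\<^sub>F p in sequentially. a p * z ^ p \<le> C"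
  shows "limsup (\<lambda>p. ennreal (root p (a p))) \<le> ennreal (1 / z)"
proof -
  \<comment> \<open>Taking the maximum with 1 makes the constant positive even when \<open>C\<close>
    is not, so that \<open>root p D\<close> tends to 1.\<close>
  define D where "D = max C 1"
  have "(\<lambda>p. ennreal (root p D / z)) \<longlonglongrightarrow> ennreal (1 / z)"
    using assms(1) by (intro tendsto_ennrealI tendsto_divide LIMSEQ_root_const) (auto simp: D_def)
  then have lim: "limsup (\<lambda>p. ennreal (root p D / z)) = ennreal (1 / z)"
    by (intro lim_imp_Limsup) auto
  have "\<forall>\<^sub>F p in sequentially. ennreal (root p (a p)) \<le> ennreal (root p D / z)"
    \<comment> \<open>The index 0 is discarded because \<open>root 0\<close> is constantly 0, so the
      cancellation of root against power fails there.\<close>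
    using bound eventually_gt_at_top[of 0]
  proof eventually_elim
    case (elim p)
    have "root p (a p) * z = root p (a p * z ^ p)"
      using assms(1) elim by (simp add: real_root_mult real_root_power_cancel)
    also have "\<dots> \<le> root p D"
      using elim by (simp add: D_def)
    finally show ?case
      using assms(1) by (intro ennreal_leI) (simp add: pos_le_divide_eq)
  qed
  then show ?thesis
    unfolding lim[symmetric] by (rule Limsup_mono)
qed

text \<open>Every family in \<open>ennreal\<close> is summable, so enlarging the index set from a
  singleton can only increase the sum.\<close>

lemma term_le_infsum_ennreal:
  fixes f :: "'a \<Rightarrow> ennreal"
  assumes "x \<in> A"
  shows "f x \<le> (\<Sum>\<^sub>\<infinity>y\<in>A. f y)"
proof -
  have "infsum f {x} \<le> infsum f A"
    using assms by (intro infsum_mono_neutral nonneg_summable_on_complete) auto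
  then show ?thesis by simp
qed

text \<open>The argument concerns only the size of the gradient. It is therefore carried out for an
  extended nonnegative \<open>f\<close> on a finite measure space.\<close>

lemma esssup_le_of_power_series:
  fixes f :: "'a \<Rightarrow> ennreal" and a :: "nat \<Rightarrow> real" and \<sigma> :: ennreal
  assumes meas: "f \<in> borel_measurable M"
    and fin: "emeasure M (space M) < \<infinity>"
    and nonneg: "\<And>p. p \<ge> k \<Longrightarrow> a p \<ge> 0"
    and \<sigma>: "1 / \<sigma> = limsup (\<lambda>p. ennreal (root p (a p)))"
    and sum: "(\<Sum>\<^sub>\<infinity>p\<in>{k..}. ennreal (a p) * (\<integral>\<^sup>+x. f x ^ p \<partial>M)) < \<infinity>"
  shows "esssup M f \<le> \<sigma>"
proof (rule ccontr)
  assume "\<not> esssup M f \<le> \<sigma>"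
  \<comment> \<open>A level strictly between the two is finite, is exceeded on a set of positive
    measure, and leaves a gap above \<sigma> for the final contradiction.\<close>
  then obtain y where y: "\<sigma> < y" "y < esssup M f"
    by (auto simp: not_le dest: dense)
  have "y < top"
    using y(2) top_greatest by (rule less_le_trans)
  then obtain z where z: "y = ennreal z" "z \<ge> 0"
    by (cases y) auto
  have "z > 0"
    using y(1) z by (cases "z = 0") auto
  define A where "A = {x \<in> space M. f x > y}"
  have A: "A \<in> sets M"
    unfolding A_def using meas by measurable
  have "emeasure M A > 0"
    unfolding A_def using meas y(2) by (rule esssup_pos_measure)
  moreover have "emeasure M A < \<infinity>"
    using fin emeasure_space[of M A] le_less_trans by blast
  ultimately obtain m where m: "emeasure M A = ennreal m" "m > 0"
    by (cases "emeasure M A") (auto simp: less_top)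
  obtain S where S: "(\<Sum>\<^sub>\<infinity>p\<in>{k..}. ennreal (a p) * (\<integral>\<^sup>+x. f x ^ p \<partial>M)) = ennreal S" "S \<ge> 0"
    using sum by (cases "\<Sum>\<^sub>\<infinity>p\<in>{k..}. ennreal (a p) * (\<integral>\<^sup>+x. f x ^ p \<partial>M)") auto
  \<comment> \<open>This is Chebyshev's inequality: \<open>f\<close> exceeds \<open>y\<close> on
    \<open>A\<close>, so its p-th moment is at least \<open>y ^ p\<close> times the measure of
    \<open>A\<close>. The bound \<open>S / m\<close> does not depend on \<open>p\<close>.\<close>
  have "a p * z ^ p \<le> S / m" if p: "p \<ge> k" for p
  proof -
    have "y ^ p * emeasure M A = (\<integral>\<^sup>+x. y ^ p * indicator A x \<partial>M)"
      using A by (simp add: nn_integral_cmult_indicator)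
    also have "\<dots> \<le> (\<integral>\<^sup>+x. f x ^ p \<partial>M)"
      by (intro nn_integral_mono) (auto simp: A_def indicator_def intro!: power_mono)
    finally have "ennreal (a p) * (y ^ p * emeasure M A) \<le> ennreal (a p) * (\<integral>\<^sup>+x. f x ^ p \<partial>M)"
      by (rule mult_left_mono) simp
    also have "\<dots> \<le> ennreal S"
      unfolding S(1)[symmetric] using p by (intro term_le_infsum_ennreal) auto
    also have "ennreal (a p) * (y ^ p * emeasure M A) = ennreal (a p * (z ^ p * m))"
      using z m nonneg[OF p] by (simp add: ennreal_power ennreal_mult)
    finally show ?thesis
      using S(2) m(2) by (simp add: pos_le_divide_eq mult.assoc)
  qed
  then have "\<forall>\<^sub>F p in sequentially. a p * z ^ p \<le> S / m"
    by (rule eventually_sequentiallyI)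
  then have le: "1 / \<sigma> \<le> ennreal (1 / z)"
    unfolding \<sigma> using \<open>z > 0\<close> by (rule limsup_root_le_inverse[rotated])
  obtain s where s: "\<sigma> = ennreal s" "s \<ge> 0"
    using y(1) \<open>y < top\<close> by (cases \<sigma>) auto
  have "s < z"
    using y(1) s z by (simp add: ennreal_less_iff)
  show False
  \<comment> \<open>In \<open>ennreal\<close>, \<open>1 / 0\<close> is \<infinity>, which cannot lie
    below the finite number \<open>1 / z\<close>. For positive \<open>s\<close> the reciprocals are
    real and reverse \<open>s < z\<close>.\<close>
  proof (cases "s = 0")
    case True
    then show False using le s by (simp add: ennreal_divide_zero top_unique)
  next
    case False
    then have "1 / \<sigma> = ennreal (1 / s)"
      using s divide_ennreal[of 1 s] by simp
    then have "1 / s \<le> 1 / z"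
      using le \<open>z > 0\<close> by simp
    then show False
      using \<open>s < z\<close> s False by (simp add: field_simps)
  qed
qed

text \<open>An open set is a countable union of compact subsets; integrability gives measurability
  on each, and the pieces are glued. This matters because \<open>esssup\<close> is
  \<open>top\<close> by convention for a non-measurable function.\<close>

lemma L1_loc_borel_measurable:
  assumes "open \<Omega>" and f: "f \<in> L1_loc \<Omega>"
  shows "f \<in> borel_measurable (lebesgue_on \<Omega>)"
proof -
  obtain K :: "nat \<Rightarrow> 'a set" where K: "\<And>n. compact (K n)" "\<And>n. K n \<subseteq> \<Omega>" "(\<Union>n. K n) = \<Omega>"
    using open_Union_compact_subsets[OF assms(1)] by metis
  show ?thesis
  proof (rule measurable_piecewise_restrict[where C = "range K"])
    show "countable (range K)" "space (lebesgue_on \<Omega>) \<subseteq> \<Union>(range K)"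
      using K(3) by auto
  next
    fix X assume "X \<in> range K"
    then have X: "compact X" "X \<subseteq> \<Omega>"
      using K by auto
    have X_sets: "X \<in> sets lebesgue"
      using lmeasurable_compact[OF X(1)] by (rule fmeasurableD)
    show "X \<inter> space (lebesgue_on \<Omega>) \<in> sets (lebesgue_on \<Omega>)"
      using X_sets
      by (auto simp: sets_restrict_space Int_commute intro!: imageI)
    have "f absolutely_integrable_on X"
      using f X by (simp add: L1_loc_def)
    then have "f \<in> borel_measurable (lebesgue_on X)"
      using absolutely_integrable_measurable[OF X_sets] by blast
    then show "f \<in> borel_measurable (restrict_space (lebesgue_on \<Omega>) X)"
      using X(2) X_sets assms(1) by (simp add: restrict_restrict_space Int_absorb1)
  qed
qed

theorem proposition2p5:
  fixes \<Omega> :: "(real ^ 'n) set"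
    and a :: "nat \<Rightarrow> real"
    and \<sigma> :: ennreal
    and u :: "real ^ 'n \<Rightarrow> real"
    and grad_u :: "real ^ 'n \<Rightarrow> real ^ 'n"
  assumes "bounded \<Omega>" and "connected \<Omega>" and "open \<Omega>" and "lipschitz_boundary \<Omega>"
    and "\<And>p. p \<ge> 2 \<Longrightarrow> a p \<ge> 0"
    and "a 2 > 0"
    and "infinite {p. p \<ge> 2 \<and> a p \<noteq> 0}"
    and "1 / \<sigma> = limsup (\<lambda>p. ennreal (root p (a p)))"
    and "u \<in> W11_loc \<Omega>"
    and "weak_gradient \<Omega> u grad_u"
    and "(\<Sum>\<^sub>\<infinity>p\<in>{2..}. ennreal (a p) * (\<integral>\<^sup>+x\<in>\<Omega>. ennreal (norm (grad_u x) ^ p) \<partial>lebesgue)) < \<infinity>"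
  shows "Linfty_norm \<Omega> grad_u \<le> \<sigma>"
proof -
  have "grad_u \<in> L1_loc \<Omega>"
    using assms(10) by (simp add: weak_gradient_def)
  then have "grad_u \<in> borel_measurable (lebesgue_on \<Omega>)"
    using assms(3) by (rule L1_loc_borel_measurable[rotated])
  moreover have "emeasure (lebesgue_on \<Omega>) (space (lebesgue_on \<Omega>)) < \<infinity>"
    using assms(1,3) emeasure_bounded_finite[OF assms(1)]
    by (simp add: emeasure_restrict_space)
  \<comment> \<open>The moments in the hypothesis integrate over \<Omega> by an indicator and take
    powers in the reals; the general lemma uses the restricted measure and powers in
    \<open>ennreal\<close>.\<close>
  moreover have "(\<integral>\<^sup>+x. ennreal (norm (grad_u x)) ^ p \<partial>lebesgue_on \<Omega>)
      = (\<integral>\<^sup>+x\<in>\<Omega>. ennreal (norm (grad_u x) ^ p) \<partial>lebesgue)" for p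
    using assms(3) by (simp add: nn_integral_restrict_space ennreal_power)
  ultimately show ?thesis
    unfolding Linfty_norm_def using assms(5,8,11)
    by (intro esssup_le_of_power_series[where k = 2 and a = a]) auto
qed

end
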